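(* Let $X$ be a Banach space, let $(A_n)_{n\in\mathbb{N}}$ be a sequence in $\mathcal{B}(X)$ defining the system $(\mathcal{A}):\ x_{n+1}=A_nx_n$, let $h,k:\mathbb{N}\to[1,\infty)$ be growth rates, and let $(P_n)_{n\in\mathbb{N}}$ be a sequence of projectors that is strongly invariant for $(\mathcal{A})$, with complementary sequence $Q_n=I-P_n$ and skew-evolution operator $B$. Then the pair $(\mathcal{A},P)$ is $(h,k)$-dichotomic if and only if there exist a sequence of norms $\{|||\cdot|||_n : n\in\mathbb{N}\}$ on $X$, compatible with $(P_n)$, and a nondecreasing sequence $b:\mathbb{N}\to[1,\infty)$ such that for all $m\ge n\ge 0$ and all $x\in X$: $$\sum_{j=0}^{n}h_m\,|||A_m^jP_jx|||_m\le b_nh_n\,|||x|||_n \quad\text{and}\quad \sum_{j=0}^{n}\frac{|||B_m^jQ_mx|||_j}{k_j}\le b_m\frac{|||x|||_m}{k_m}.$$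
   Context: $\mathbb{N}$ is the set of nonnegative integers, $\mathcal{B}(X)$ is the algebra of bounded linear operators on $X$, $\|\cdot\|$ denotes the norm on $X$ and on $\mathcal{B}(X)$, and $I$ is the identity. For $m\ge n$, the evolution operator is $A_m^n=A_{m-1}\cdots A_n$ if $m>n$ and $A_n^n=I$. A sequence $(P_n)$ in $\mathcal{B}(X)$ is a sequence of projectors if $P_n^2=P_n$ for all $n$. It is invariant for $(\mathcal{A})$ if $A_nP_n=P_{n+1}A_n$ for all $n$. It is strongly invariant if it is invariant and, for all $m\ge n$, the restriction of $A_m^n$ to $\operatorname{Ker}P_n$ is an isomorphism from $\operatorname{Ker}P_n$ onto $\operatorname{Ker}P_m$. In that case, for $m\ge n$, $B_m^n$ (the skew-evolution operator) denotes the isomorphism $\operatorname{Ker}P_m\to\operatorname{Ker}P_n$ inverse to $A_m^n|_{\operatorname{Ker}P_n}$, so that $A_m^nB_m^nQ_m=Q_m$, $B_m^nA_m^nQ_n=Q_n$ and $Q_nB_m^nQ_m=B_m^nQ_m$. A growth rate is an increasing sequence $h:\mathbb{N}\to[1,\infty)$ with $\lim_{n\to\infty}h_n=\infty$. The pair $(\mathcal{A},P)$ is $(h,k)$-dichotomic if there is a nondecreasing sequence $d:\mathbb{N}\to[1,\infty)$ such that $h_m\|A_m^nP_nx\|\le d_nh_n\|P_nx\|$ and $k_m\|Q_nx\|\le d_mk_n\|A_m^nQ_nx\|$ for all $m\ge n\ge0$ and $x\in X$. A sequence of norms $\{|||\cdot|||_n\}$ on $X$ is compatible with $(P_n)$ if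 there is a nondecreasing sequence $c:\mathbb{N}\to[1,\infty)$ such that $\|x\|\le|||x|||_n\le c_n(\|P_nx\|+\|Q_nx\|)$ for all $n\in\mathbb{N}$, $x\in X$. *)

theory Defs
  imports "HOL-Analysis.Analysis"
begin

text \<open>The evolution operator \<open>A\<^sub>m\<^sup>n = A\<^bsub>m-1\<^esub> \<dots> A\<^sub>n\<close> (identity for \<open>m = n\<close>) is \<open>evol A m n\<close>.
  It is only meant to be used for \<open>n \<le> m\<close>; for \<open>m < n\<close> it returns the identity.\<close>

primrec evol :: "(nat \<Rightarrow> 'a::real_normed_vector \<Rightarrow>\<^sub>L 'a) \<Rightarrow> nat \<Rightarrow> nat \<Rightarrow> 'a \<Rightarrow>\<^sub>L 'a" where
  "evol A 0 n = id_blinfun"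
| "evol A (Suc m) n = (if n \<le> m then A m o\<^sub>L evol A m n else id_blinfun)"

definition ker :: "'a::real_normed_vector \<Rightarrow>\<^sub>L 'b::real_normed_vector \<Rightarrow> 'a set" where
  "ker T = {x. blinfun_apply T x = 0}"

definition projectors :: "(nat \<Rightarrow> 'a::real_normed_vector \<Rightarrow>\<^sub>L 'a) \<Rightarrow> bool" where
  "projectors P \<longleftrightarrow> (\<forall>n. P n o\<^sub>L P n = P n)"

definition compl :: "(nat \<Rightarrow> 'a::real_normed_vector \<Rightarrow>\<^sub>L 'a) \<Rightarrow> nat \<Rightarrow> 'a \<Rightarrow>\<^sub>L 'a" where
  "compl P n = id_blinfun - P n"

definition invariant_for ::
  "(nat \<Rightarrow> 'a::real_normed_vector \<Rightarrow>\<^sub>L 'a) \<Rightarrow> (nat \<Rightarrow> 'a \<Rightarrow>\<^sub>L 'a) \<Rightarrow> bool" where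
  "invariant_for A P \<longleftrightarrow> (\<forall>n. A n o\<^sub>L P n = P (Suc n) o\<^sub>L A n)"

text \<open>The restriction of the bounded operator \<open>A\<^sub>m\<^sup>n\<close> to a kernel is linear and bounded, so being an
  isomorphism amounts to being a bijection between the kernels; on a Banach space the inverse is
  automatically bounded, the kernels being closed.\<close>

definition strongly_invariant ::
  "(nat \<Rightarrow> 'a::real_normed_vector \<Rightarrow>\<^sub>L 'a) \<Rightarrow> (nat \<Rightarrow> 'a \<Rightarrow>\<^sub>L 'a) \<Rightarrow> bool" where
  "strongly_invariant A P \<longleftrightarrow> invariant_for A P \<and>
     (\<forall>m n. n \<le> m \<longrightarrow> bij_betw (blinfun_apply (evol A m n)) (ker (P n)) (ker (P m)))"

text \<open>\<open>skew_evol A P m n\<close> is \<open>B\<^sub>m\<^sup>n\<close>, the inverse of the restriction of \<open>A\<^sub>m\<^sup>n\<close> to \<open>ker (P n)\<close>. Its values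
  are meaningful only on \<open>ker (P m)\<close>, for \<open>n \<le> m\<close> and strongly invariant \<open>P\<close>.\<close>

definition skew_evol ::
  "(nat \<Rightarrow> 'a::real_normed_vector \<Rightarrow>\<^sub>L 'a) \<Rightarrow> (nat \<Rightarrow> 'a \<Rightarrow>\<^sub>L 'a) \<Rightarrow> nat \<Rightarrow> nat \<Rightarrow> 'a \<Rightarrow> 'a" where
  "skew_evol A P m n = inv_into (ker (P n)) (blinfun_apply (evol A m n))"

text \<open>"Increasing" is read as strictly increasing, as opposed to "nondecreasing" below.\<close>

definition growth_rate :: "(nat \<Rightarrow> real) \<Rightarrow> bool" where
  "growth_rate h \<longleftrightarrow> (\<forall>n. 1 \<le> h n) \<and> strict_mono h \<and> filterlim h at_top sequentially"

definition dichotomic ::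
  "(nat \<Rightarrow> real) \<Rightarrow> (nat \<Rightarrow> real) \<Rightarrow>
   (nat \<Rightarrow> 'a::real_normed_vector \<Rightarrow>\<^sub>L 'a) \<Rightarrow> (nat \<Rightarrow> 'a \<Rightarrow>\<^sub>L 'a) \<Rightarrow> bool" where
  "dichotomic h k A P \<longleftrightarrow>
     (\<exists>d :: nat \<Rightarrow> real. mono d \<and> (\<forall>n. 1 \<le> d n) \<and>
       (\<forall>m n x. n \<le> m \<longrightarrow>
          h m * norm (evol A m n (P n x)) \<le> d n * h n * norm (P n x) \<and>
          k m * norm (compl P n x) \<le> d m * k n * norm (evol A m n (compl P n x))))"

definition is_norm :: "('a::real_vector \<Rightarrow> real) \<Rightarrow> bool" where
  "is_norm N \<longleftrightarrow> (\<forall>x. 0 \<le> N x) \<and> (\<forall>x. N x = 0 \<longleftrightarrow> x = 0) \<and>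
     (\<forall>r x. N (r *\<^sub>R x) = \<bar>r\<bar> * N x) \<and> (\<forall>x y. N (x + y) \<le> N x + N y)"

definition compatible ::
  "(nat \<Rightarrow> 'a::real_normed_vector \<Rightarrow> real) \<Rightarrow> (nat \<Rightarrow> 'a \<Rightarrow>\<^sub>L 'a) \<Rightarrow> bool" where
  "compatible N P \<longleftrightarrow>
     (\<exists>c :: nat \<Rightarrow> real. mono c \<and> (\<forall>n. 1 \<le> c n) \<and>
       (\<forall>n x. norm x \<le> N n x \<and> N n x \<le> c n * (norm (P n x) + norm (compl P n x))))"

end

theory Submission
  imports Defs
begin

text \<open>Compatibility only bounds the norms by constants depending on the index, and \<open>b\<close> may depend on
  the index as well. So the original norm already works in the forward direction: \<open>b\<close> absorbs
  the norms of the projectors together with the finitely many summands. Conversely, the summand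
  \<open>j = n\<close> alone, evaluated at \<open>P\<^sub>n x\<close> and at \<open>A\<^sub>m\<^sup>n Q\<^sub>n x\<close>, gives the two dichotomy estimates
  with \<open>d = b c\<close>.\<close>

lemma compl_apply: "compl P n x = x - P n x"
  by (simp add: compl_def blinfun.diff_left)

lemma projectors_idem: "projectors P \<Longrightarrow> P n (P n x) = P n x"
  unfolding projectors_def by (metis blinfun_apply_blinfun_compose)

lemma compl_in_ker: "projectors P \<Longrightarrow> compl P n x \<in> ker (P n)"
  by (simp add: ker_def compl_apply blinfun.diff_right projectors_idem)

lemma compl_eq_self: "x \<in> ker (P n) \<Longrightarrow> compl P n x = x"
  by (simp add: ker_def compl_apply)

lemma evol_bij_betw_ker:
  "strongly_invariant A P \<Longrightarrow> n \<le> m \<Longrightarrow> bij_betw (evol A m n) (ker (P n)) (ker (P m))"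
  by (simp add: strongly_invariant_def)

lemma evol_in_ker:
  assumes "strongly_invariant A P" "n \<le> m" "x \<in> ker (P n)"
  shows "evol A m n x \<in> ker (P m)"
  using bij_betwE[OF evol_bij_betw_ker[OF assms(1,2)]] assms(3) by blast

lemma skew_evol_in_ker:
  assumes "strongly_invariant A P" "n \<le> m" "y \<in> ker (P m)"
  shows "skew_evol A P m n y \<in> ker (P n)"
  using evol_bij_betw_ker[OF assms(1,2)] assms(3) unfolding skew_evol_def
  by (metis bij_betw_imp_surj_on inv_into_into)

text \<open>\<open>skew_evol\<close> is built on \<open>inv_into\<close>, whose value is arbitrary
  outside the image of \<open>ker (P n)\<close>. Surjectivity onto \<open>ker (P m)\<close> makes it
  a true right inverse there.\<close>

lemma evol_skew_evol:
  assumes "strongly_invariant A P" "n \<le> m" "y \<in> ker (P m)"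
  shows "evol A m n (skew_evol A P m n y) = y"
  using evol_bij_betw_ker[OF assms(1,2)] assms(3) unfolding skew_evol_def
  by (rule bij_betw_inv_into_right)

lemma skew_evol_evol:
  assumes "strongly_invariant A P" "n \<le> m" "x \<in> ker (P n)"
  shows "skew_evol A P m n (evol A m n x) = x"
  using evol_bij_betw_ker[OF assms(1,2)] assms(3) unfolding skew_evol_def
  by (rule bij_betw_inv_into_left)

lemma is_norm_norm: "is_norm norm"
  by (simp add: is_norm_def norm_triangle_ineq)

text \<open>Since x = P x + Q x, the triangle inequality allows the constant 1.\<close>

lemma compatible_norm: "compatible (\<lambda>n. norm) P"
proof -
  have "norm x \<le> norm (P n x) + norm (compl P n x)" for n x
    using norm_triangle_ineq[of "P n x" "compl P n x"] by (simp add: compl_apply)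
  then show ?thesis
    unfolding compatible_def by (intro exI[of _ "\<lambda>_. 1"]) (simp add: mono_def)
qed

lemma growth_rate_ge_1: "growth_rate h \<Longrightarrow> 1 \<le> h n"
  by (simp add: growth_rate_def)

text \<open>The second dichotomy estimate is applied at the point B Q x of \<open>ker (P n)\<close>,
  which the evolution carries to Q x. This turns a lower bound for the evolution on the kernels into
  an upper bound for its inverse.\<close>

lemma norm_skew_evol_le:
  assumes "growth_rate k" "projectors P" "strongly_invariant A P" "n \<le> m"
    and d: "\<And>x. k m * norm (compl P n x) \<le> d m * k n * norm (evol A m n (compl P n x))"
  shows "norm (skew_evol A P m n (compl P m x)) / k n \<le> d m * norm (compl P m x) / k m"
proof -
  have pos: "0 < k i" for i
    using growth_rate_ge_1[OF assms(1), of i] by simp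
  let ?y = "skew_evol A P m n (compl P m x)"
  have "compl P n ?y = ?y"
    by (intro compl_eq_self skew_evol_in_ker compl_in_ker assms)
  moreover have "evol A m n ?y = compl P m x"
    by (intro evol_skew_evol compl_in_ker assms)
  ultimately have "k m * norm ?y \<le> d m * k n * norm (compl P m x)"
    using d[of ?y] by simp
  then show ?thesis
    using pos[of m] pos[of n] by (simp add: field_simps)
qed

lemma dichotomic_imp_sums_le:
  fixes A P :: "nat \<Rightarrow> 'a::real_normed_vector \<Rightarrow>\<^sub>L 'a"
  assumes h: "growth_rate h" and k: "growth_rate k"
    and P: "projectors P" and A: "strongly_invariant A P"
    and dich: "dichotomic h k A P"
  obtains b :: "nat \<Rightarrow> real" where "mono b" "\<And>n. 1 \<le> b n"
    "\<And>m n x. n \<le> m \<Longrightarrow> (\<Sum>j=0..n. h m * norm (evol A m j (P j x))) \<le> b n * h n * norm x"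
    "\<And>m n x. n \<le> m \<Longrightarrow>
      (\<Sum>j=0..n. norm (skew_evol A P m j (compl P m x)) / k j) \<le> b m * (norm x / k m)"
proof -
  obtain d :: "nat \<Rightarrow> real" where d1: "\<And>n. 1 \<le> d n"
    and dP: "\<And>m n x. n \<le> m \<Longrightarrow> h m * norm (evol A m n (P n x)) \<le> d n * h n * norm (P n x)"
    and dQ: "\<And>m n x. n \<le> m \<Longrightarrow>
      k m * norm (compl P n x) \<le> d m * k n * norm (evol A m n (compl P n x))"
    using dich unfolding dichotomic_def by blast
  have h1: "1 \<le> h i" and k1: "1 \<le> k i" for i
    using h k by (simp_all add: growth_rate_ge_1)
  have d0: "0 \<le> d i" and h0: "0 \<le> h i" and k0: "0 < k i" for i
    using d1[of i] h1[of i] k1[of i] by linarith+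
  \<comment> \<open>In the first sum, \<open>u j * norm x\<close> will bound the summand of index j.
    In the second, all summands share one bound depending on m, and there are at most
    \<open>Suc m\<close> of them, whence the factor in \<open>v\<close>.\<close>
  define u where "u j = d j * h j * norm (P j)" for j
  define v where "v j = real (Suc j) * (d j * norm (compl P j))" for j
  \<comment> \<open>Partial sums are taken because the norms of the projectors may vary
    non-monotonically in j, while \<open>b\<close> has to be nondecreasing. The leading 1 secures
    \<open>1 \<le> b n\<close>.\<close>
  define b where "b n = 1 + (\<Sum>j\<le>n. u j) + (\<Sum>j\<le>n. v j)" for n
  have u0: "0 \<le> u j" and v0: "0 \<le> v j" for j
    by (simp_all add: u_def v_def d0 h0)
  have su: "(\<Sum>j\<le>n. u j) \<le> b n" for n
    using sum_nonneg[of "{..n}" v] v0 by (simp add: b_def)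
  have sv: "v n \<le> b n" for n
    using member_le_sum[of n "{..n}" v] sum_nonneg[of "{..n}" u] u0 v0 by (simp add: b_def)
  have b1: "1 \<le> b n" for n
    using sum_nonneg[of "{..n}" u] sum_nonneg[of "{..n}" v] u0 v0 by (simp add: b_def)
  show ?thesis
  proof (rule that[of b])
    show "mono b"
      by (rule monoI) (auto simp: b_def intro!: add_mono sum_mono2 u0 v0)
    show "1 \<le> b n" for n
      by (rule b1)
  next
    fix m n :: nat and x :: 'a
    assume nm: "n \<le> m"
    have "h m * norm (evol A m j (P j x)) \<le> u j * norm x" if "j \<le> n" for j
    proof -
      have "h m * norm (evol A m j (P j x)) \<le> d j * h j * norm (P j x)"
        using dP that nm by simp
      also have "\<dots> \<le> d j * h j * (norm (P j) * norm x)"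
        by (intro mult_left_mono norm_blinfun mult_nonneg_nonneg d0 h0)
      finally show ?thesis by (simp add: u_def mult.assoc)
    qed
    then have "(\<Sum>j=0..n. h m * norm (evol A m j (P j x))) \<le> (\<Sum>j\<le>n. u j) * norm x"
      unfolding sum_distrib_right by (auto simp: atLeast0AtMost intro!: sum_mono)
    also have "\<dots> \<le> b n * norm x"
      by (intro mult_right_mono su norm_ge_zero)
    \<comment> \<open>The weights \<open>h j\<close> already sit inside \<open>u\<close>; the factor
      \<open>h n\<close> is inserted using \<open>1 \<le> h n\<close>.\<close>
    also have "\<dots> \<le> b n * h n * norm x"
      using mult_left_mono[OF h1[of n], of "b n"] b1[of n] by (intro mult_right_mono) auto
    finally show "(\<Sum>j=0..n. h m * norm (evol A m j (P j x))) \<le> b n * h n * norm x" .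
  next
    fix m n :: nat and x :: 'a
    assume nm: "n \<le> m"
    \<comment> \<open>This common bound of the summands is independent of j and n, so that summing
      amounts to counting.\<close>
    define r where "r = d m * norm (compl P m) * (norm x / k m)"
    have r0: "0 \<le> r"
      using k0[of m] by (simp add: r_def d0)
    have "norm (skew_evol A P m j (compl P m x)) / k j \<le> r" if "j \<le> n" for j
    proof -
      have jm: "j \<le> m" using that nm by simp
      have "norm (skew_evol A P m j (compl P m x)) / k j \<le> d m * norm (compl P m x) / k m"
        by (rule norm_skew_evol_le[where d = d, OF k P A jm dQ[OF jm]])
      also have "\<dots> \<le> d m * (norm (compl P m) * norm x) / k m"
        using k0[of m] by (intro divide_right_mono mult_left_mono norm_blinfun d0) simp
      finally show ?thesis by (simp add: r_def mult.assoc)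
    qed
    then have "(\<Sum>j=0..n. norm (skew_evol A P m j (compl P m x)) / k j) \<le> real (Suc n) * r"
      using sum_bounded_above[of "{0..n}" _ r] by simp
    also have "\<dots> \<le> real (Suc m) * r"
      using nm r0 by (intro mult_right_mono) auto
    also have "\<dots> = v m * (norm x / k m)"
      by (simp add: v_def r_def)
    also have "\<dots> \<le> b m * (norm x / k m)"
      using k0[of m] by (intro mult_right_mono sv) simp
    finally show "(\<Sum>j=0..n. norm (skew_evol A P m j (compl P m x)) / k j) \<le> b m * (norm x / k m)" .
  qed
qed

lemma sums_le_imp_dichotomic:
  fixes A P :: "nat \<Rightarrow> 'a::real_normed_vector \<Rightarrow>\<^sub>L 'a"
  assumes h: "growth_rate h" and k: "growth_rate k"
    and P: "projectors P" and A: "strongly_invariant A P"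
    and "compatible N P" and b: "mono b" "\<And>n. 1 \<le> b n"
    and sumP: "\<And>m n x. n \<le> m \<Longrightarrow>
      (\<Sum>j=0..n. h m * N m (evol A m j (P j x))) \<le> b n * h n * N n x"
    and sumQ: "\<And>m n x. n \<le> m \<Longrightarrow>
      (\<Sum>j=0..n. N j (skew_evol A P m j (compl P m x)) / k j) \<le> b m * (N m x / k m)"
  shows "dichotomic h k A P"
proof -
  obtain c :: "nat \<Rightarrow> real" where c: "mono c" "\<And>n. 1 \<le> c n"
    and lo: "\<And>n x. norm x \<le> N n x"
    and up: "\<And>n x. N n x \<le> c n * (norm (P n x) + norm (compl P n x))"
    using \<open>compatible N P\<close> unfolding compatible_def by blast
  have h0: "0 < h i" and k0: "0 < k i" for i
    using growth_rate_ge_1[OF h, of i] growth_rate_ge_1[OF k, of i] by linarith+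
  have b0: "0 \<le> b i" and c0: "0 \<le> c i" for i
    using b(2)[of i] c(2)[of i] by linarith+
  \<comment> \<open>Nonnegativity is what allows a sum to be bounded below by its summand of index
    n.\<close>
  have N0: "0 \<le> N n x" for n x
    using lo[of x n] norm_ge_zero[of x] by linarith
  have "mono (\<lambda>n. b n * c n)"
    using b(1) c(1) by (auto simp: mono_def intro!: mult_mono b0 c0)
  moreover have "1 \<le> b n * c n" for n
    using mult_mono[OF b(2) c(2), of n n] b0[of n] by simp
  moreover have "h m * norm (evol A m n (P n x)) \<le> b n * c n * h n * norm (P n x)"
    if nm: "n \<le> m" for m n x
  proof -
    \<comment> \<open>Doubling the projector by idempotence exhibits the term as the last summand of
      \<open>sumP\<close> at the point \<open>P n x\<close>.\<close>
    have "h m * norm (evol A m n (P n x)) \<le> h m * N m (evol A m n (P n (P n x)))"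
      using lo h0[of m] by (simp add: projectors_idem[OF P])
    also have "\<dots> \<le> (\<Sum>j=0..n. h m * N m (evol A m j (P j (P n x))))"
      using N0 h0[of m] by (intro member_le_sum) (auto intro!: mult_nonneg_nonneg)
    also have "\<dots> \<le> b n * h n * N n (P n x)"
      by (rule sumP[OF nm])
    \<comment> \<open>The complementary projector annihilates \<open>P n x\<close>, so only one term
      of the compatibility bound survives.\<close>
    also have "\<dots> \<le> b n * h n * (c n * norm (P n x))"
      using up[of n "P n x"] b0[of n] h0[of n]
      by (intro mult_left_mono) (simp_all add: compl_apply projectors_idem[OF P])
    finally show ?thesis by (simp add: mult_ac)
  qed
  moreover have "k m * norm (compl P n x) \<le> b m * c m * k n * norm (evol A m n (compl P n x))"
    if nm: "n \<le> m" for m n x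
  proof -
    let ?q = "compl P n x" and ?y = "evol A m n (compl P n x)"
    have q: "?q \<in> ker (P n)" by (rule compl_in_ker[OF P])
    have y: "?y \<in> ker (P m)" by (rule evol_in_ker[OF A nm q])
    have Qy: "compl P m ?y = ?y" by (rule compl_eq_self[where P = P, OF y])
    \<comment> \<open>As \<open>?y\<close> is the image of \<open>?q\<close> and lies in
      \<open>ker (P m)\<close>, the skew-evolution operator recovers \<open>?q\<close> from
      it.\<close>
    have "norm ?q / k n \<le> N n (skew_evol A P m n (compl P m ?y)) / k n"
      using lo k0[of n] by (simp add: Qy skew_evol_evol[OF A nm q] divide_right_mono)
    also have "\<dots> \<le> (\<Sum>j=0..n. N j (skew_evol A P m j (compl P m ?y)) / k j)"
      using N0 k0
      by (intro member_le_sum[where f = "\<lambda>j. N j (skew_evol A P m j (compl P m ?y)) / k j"])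
        (auto simp: less_imp_le)
    also have "\<dots> \<le> b m * (N m ?y / k m)"
      by (rule sumQ[OF nm])
    \<comment> \<open>Here \<open>P m\<close> annihilates \<open>?y\<close>, which leaves only the
      complementary term of the compatibility bound.\<close>
    also have "\<dots> \<le> b m * (c m * norm ?y / k m)"
      using up[of m ?y] y b0[of m] k0[of m]
      by (intro mult_left_mono divide_right_mono) (simp_all add: Qy ker_def)
    finally show ?thesis
      using k0[of m] k0[of n] by (simp add: field_simps)
  qed
  ultimately show ?thesis
    unfolding dichotomic_def by (intro exI[of _ "\<lambda>n. b n * c n"]) blast
qed

theorem theorem6:
  fixes A P :: "nat \<Rightarrow> 'a::banach \<Rightarrow>\<^sub>L 'a"
    and h k :: "nat \<Rightarrow> real"
  assumes "growth_rate h" and "growth_rate k"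
    and "projectors P" and "strongly_invariant A P"
  shows "dichotomic h k A P \<longleftrightarrow>
    (\<exists>(N :: nat \<Rightarrow> 'a \<Rightarrow> real) (b :: nat \<Rightarrow> real).
       (\<forall>n. is_norm (N n)) \<and> compatible N P \<and> mono b \<and> (\<forall>n. 1 \<le> b n) \<and>
       (\<forall>m n x. n \<le> m \<longrightarrow>
          (\<Sum>j=0..n. h m * N m (evol A m j (P j x))) \<le> b n * h n * N n x \<and>
          (\<Sum>j=0..n. N j (skew_evol A P m j (compl P m x)) / k j) \<le> b m * (N m x / k m)))"
proof
  assume "dichotomic h k A P"
  from dichotomic_imp_sums_le[OF assms this] obtain b :: "nat \<Rightarrow> real"
    where "mono b" "\<And>n. 1 \<le> b n"
      "\<And>m n x. n \<le> m \<Longrightarrow> (\<Sum>j=0..n. h m * norm (evol A m j (P j x))) \<le> b n * h n * norm x"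
      "\<And>m n x. n \<le> m \<Longrightarrow>
        (\<Sum>j=0..n. norm (skew_evol A P m j (compl P m x)) / k j) \<le> b m * (norm x / k m)"
    by blast
  then show "\<exists>N b. (\<forall>n. is_norm (N n)) \<and> compatible N P \<and> mono b \<and> (\<forall>n. 1 \<le> b n) \<and>
       (\<forall>m n x. n \<le> m \<longrightarrow>
          (\<Sum>j=0..n. h m * N m (evol A m j (P j x))) \<le> b n * h n * N n x \<and>
          (\<Sum>j=0..n. N j (skew_evol A P m j (compl P m x)) / k j) \<le> b m * (N m x / k m))"
    using is_norm_norm compatible_norm
    \<comment> \<open>The witness is the constant family equal to the original norm.\<close>
    by (intro exI[of _ "\<lambda>_. norm"] exI[of _ b]) blast
next
  assume "\<exists>N b. (\<forall>n. is_norm (N n)) \<and> compatible N P \<and> mono b \<and> (\<forall>n. 1 \<le> b n) \<and>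
       (\<forall>m n x. n \<le> m \<longrightarrow>
          (\<Sum>j=0..n. h m * N m (evol A m j (P j x))) \<le> b n * h n * N n x \<and>
          (\<Sum>j=0..n. N j (skew_evol A P m j (compl P m x)) / k j) \<le> b m * (N m x / k m))"
  then show "dichotomic h k A P"
    using sums_le_imp_dichotomic[OF assms] by blast
qed

end
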